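(* Let $\mathcal{M}$ be a directed pseudoforest. Then $\mathcal{M}$ is ultrahomogeneous if and only if $\mathcal{M}=\mathcal{A}^*$ where $\mathcal{A}$ is a partial monounary algebra isomorphic to one of: (i) $\alpha\cdot\mathcal{Z}_2$ for some cardinal $\alpha$; (ii) $\alpha\cdot\mathcal{Z}_3$ for some cardinal $\alpha$; (iii) $\mathcal{Z}_4$; (iv) $(A;\theta)$ with $\mathrm{dom}(\theta)=\emptyset$.
   Context: A partial monounary algebra is a pair $\mathcal{A}=(A;\theta)$ where $A$ is a nonempty set (of arbitrary cardinality) and $\theta$ is a partial unary operation on $A$ with domain $\mathrm{dom}(\theta)\subseteq A$. Its relational form is the digraph $\mathcal{A}^*=(A;R_\theta)$ with $(x,y)\in R_\theta$ iff $x\in\mathrm{dom}(\theta)$ and $\theta(x)=y$. An isomorphism of partial monounary algebras is a bijection preserving, in both directions, the domain of the operation and commuting with it. A directed pseudoforest is a loopless digraph (with nonempty vertex set, of arbitrary cardinality; edges $(x,y)$ and $(y,x)$ may both be present) in which each vertex has at most one outgoing edge. A digraph is ultrahomogeneous if every isomorphism between finite induced subdigraphs extends to an automorphism. $\mathcal{Z}_n$ is the $n$-cycle $(\{0,\dots,n-1\};\, i\mapsto i+1 \bmod n)$, and $\alpha\cdot\mathcal{C}$ is the disjoint union of $\alpha$ copies of $\mathcal{C}$. *)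

theory Defs
  imports "Graph_Theory.Pair_Digraph" "Graph_Theory.Digraph_Component"
begin

section \<open>Partial monounary algebras\<close>

record 'a pm_algebra =
  pm_carrier :: "'a set"
  pm_op :: "'a \<rightharpoonup> 'a"

definition partial_monounary_algebra :: "'a pm_algebra \<Rightarrow> bool" where
  "partial_monounary_algebra A \<longleftrightarrow>
     pm_carrier A \<noteq> {} \<and> dom (pm_op A) \<subseteq> pm_carrier A \<and> ran (pm_op A) \<subseteq> pm_carrier A"

definition pm_isomorphism :: "'a pm_algebra \<Rightarrow> 'b pm_algebra \<Rightarrow> ('a \<Rightarrow> 'b) \<Rightarrow> bool" where
  "pm_isomorphism A B f \<longleftrightarrow>
     bij_betw f (pm_carrier A) (pm_carrier B) \<and>
     (\<forall>x\<in>pm_carrier A. f x \<in> dom (pm_op B) \<longleftrightarrow> x \<in> dom (pm_op A)) \<and>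
     (\<forall>x\<in>dom (pm_op A). the (pm_op B (f x)) = f (the (pm_op A x)))"

definition pm_isomorphic :: "'a pm_algebra \<Rightarrow> 'b pm_algebra \<Rightarrow> bool" where
  "pm_isomorphic A B \<longleftrightarrow> (\<exists>f. pm_isomorphism A B f)"

definition relational_form :: "'a pm_algebra \<Rightarrow> 'a pair_pre_digraph" where
  "relational_form A =
     \<lparr>pverts = pm_carrier A, parcs = {(x, y). x \<in> dom (pm_op A) \<and> the (pm_op A x) = y}\<rparr>"

definition cycle_algebra :: "nat \<Rightarrow> nat pm_algebra" where
  "cycle_algebra n =
     \<lparr>pm_carrier = {0..<n}, pm_op = (\<lambda>i. if i < n then Some ((i + 1) mod n) else None)\<rparr>"

text \<open>Disjoint union of copies of \<open>C\<close> indexed by a set \<open>I\<close>; the number of copies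
  is the cardinality of \<open>I\<close>. The result has empty carrier if \<open>I\<close> is empty, so no partial
  monounary algebra is isomorphic to it in that case. An algebra on type \<open>'a\<close> can only be
  isomorphic to a disjoint union of nonempty algebras if the number of copies is at most the
  cardinality of \<open>'a\<close>, so index sets over \<open>'a\<close> account for every cardinal.\<close>

definition copies :: "'i set \<Rightarrow> 'c pm_algebra \<Rightarrow> ('i \<times> 'c) pm_algebra" where
  "copies I C =
     \<lparr>pm_carrier = I \<times> pm_carrier C,
      pm_op = (\<lambda>(i, x). if i \<in> I then map_option (Pair i) (pm_op C x) else None)\<rparr>"


section \<open>Digraphs\<close>

text \<open>\<open>single_valued\<close> is used rather than a bound on the library's \<open>out_degree\<close>, which is \<open>0\<close>
  at a vertex with infinitely many outgoing arcs.\<close>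

definition directed_pseudoforest :: "'a pair_pre_digraph \<Rightarrow> bool" where
  "directed_pseudoforest M \<longleftrightarrow>
     pair_loopfree_digraph M \<and> pverts M \<noteq> {} \<and> single_valued (parcs M)"

text \<open>The library's \<open>digraph_isomorphism\<close> carries a separate map on arcs; for arcs given as
  pairs of vertices, an isomorphism is just a map on vertices.\<close>

definition pair_isomorphism ::
    "'a pair_pre_digraph \<Rightarrow> 'b pair_pre_digraph \<Rightarrow> ('a \<Rightarrow> 'b) \<Rightarrow> bool" where
  "pair_isomorphism G H f \<longleftrightarrow>
     bij_betw f (pverts G) (pverts H) \<and>
     (\<forall>x\<in>pverts G. \<forall>y\<in>pverts G. (f x, f y) \<in> parcs H \<longleftrightarrow> (x, y) \<in> parcs G)"

definition ultrahomogeneous :: "'a pair_pre_digraph \<Rightarrow> bool" where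
  "ultrahomogeneous M \<longleftrightarrow>
     (\<forall>(H :: 'a pair_pre_digraph) (K :: 'a pair_pre_digraph) f.
        induced_subgraph (with_proj H) (with_proj M) \<and> finite (pverts H) \<and>
        induced_subgraph (with_proj K) (with_proj M) \<and> finite (pverts K) \<and>
        pair_isomorphism H K f \<longrightarrow>
        (\<exists>g. pair_isomorphism M M g \<and> (\<forall>x\<in>pverts H. g x = f x)))"

end

theory Submission
  imports Defs
begin

text \<open>Once there is an arc, ultrahomogeneity makes the digraph vertex transitive, so it is the graph
  of a function \<open>f\<close>; comparing \<open>x\<close> with \<open>f (f x)\<close> then leaves only cycles of length 2, 3 or 4, and
  a single cycle in the last case. Conversely, two points outside a finite set \<open>U\<close> with
  the same arcs to \<open>U\<close> are either equal or on cycles avoiding \<open>U\<close>, which can be rotated or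
  swapped.\<close>

text \<open>The converse turns on which arcs join \<open>s\<close> and \<open>t\<close> to
  \<open>U\<close>. Every point has one image and, on a cycle, one preimage, so an arc between
  \<open>s\<close> and a point of \<open>U\<close> that \<open>t\<close> shares forces
  \<open>s = t\<close>. For distinct \<open>s\<close> and \<open>t\<close> there is thus no arc
  between \<open>U\<close> and either of them. In a cycle of length 2 or 3 any two points are
  adjacent, so the whole cycles of \<open>s\<close> and \<open>t\<close> miss \<open>U\<close> and
  can be moved freely. In a 4-cycle the opposite point is not adjacent, so \<open>U\<close> could
  meet the cycle of \<open>s\<close> there. This is why a second 4-cycle is impossible: fixing
  \<open>x\<close> fixes \<open>f (f x)\<close>, although a point of another cycle is just as
  unrelated to \<open>x\<close>. Inside a single 4-cycle the opposite point is the only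
  non-neighbour, so a nonempty \<open>U\<close> leaves no distinct \<open>s\<close> and
  \<open>t\<close>.\<close>

section \<open>Extension of finite partial automorphisms\<close>

text \<open>An induced subdigraph carries no data beyond its vertex set, so \<open>H\<close>,
  \<open>K\<close> and the isomorphism between them reduce to an injection on a finite set of
  vertices. Well-formedness of \<open>M\<close> is part of what \<open>induced_subgraph\<close>
  demands.\<close>

lemma ultrahomogeneous_iff:
  assumes "pair_wf_digraph M"
  shows "ultrahomogeneous M \<longleftrightarrow>
    (\<forall>S p. finite S \<longrightarrow> S \<subseteq> pverts M \<longrightarrow> inj_on p S \<longrightarrow> p ` S \<subseteq> pverts M \<longrightarrow>
       (\<forall>x\<in>S. \<forall>y\<in>S. (p x, p y) \<in> parcs M \<longleftrightarrow> (x, y) \<in> parcs M) \<longrightarrow>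
       (\<exists>g. pair_isomorphism M M g \<and> (\<forall>x\<in>S. g x = p x)))"
    (is "_ \<longleftrightarrow> ?R")
proof -
  have ind: "induced_subgraph (with_proj H) (with_proj M) \<longleftrightarrow>
      pverts H \<subseteq> pverts M \<and> parcs H = parcs M \<inter> pverts H \<times> pverts H" for H :: "'a pair_pre_digraph"
  proof -
    have "pair_wf_digraph H" if "parcs H = parcs M \<inter> pverts H \<times> pverts H"
      using that by (auto simp: pair_wf_digraph_def)
    then show ?thesis
      using assms
      by (auto simp: induced_subgraph_def subgraph_def compatible_def wf_digraph_wp_iff)
  qed
  show ?thesis
  proof
    assume L: "ultrahomogeneous M"
    show ?R
    proof (intro allI impI)
      fix S p
      assume S: "finite S" "S \<subseteq> pverts M" "inj_on p S" "p ` S \<subseteq> pverts M"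
        "\<forall>x\<in>S. \<forall>y\<in>S. (p x, p y) \<in> parcs M \<longleftrightarrow> (x, y) \<in> parcs M"
      let ?H = "\<lambda>T. \<lparr>pverts = T, parcs = parcs M \<inter> T \<times> T\<rparr>"
      have "induced_subgraph (with_proj (?H S)) (with_proj M)"
        "induced_subgraph (with_proj (?H (p ` S))) (with_proj M)"
        using S by (auto simp: ind)
      moreover have "pair_isomorphism (?H S) (?H (p ` S)) p"
        using S by (auto simp: pair_isomorphism_def inj_on_imp_bij_betw)
      ultimately show "\<exists>g. pair_isomorphism M M g \<and> (\<forall>x\<in>S. g x = p x)"
        using L[unfolded ultrahomogeneous_def, rule_format, of "?H S" "?H (p ` S)" p] S(1)
        by simp
    qed
  next
    assume R: ?R
    show "ultrahomogeneous M"
      unfolding ultrahomogeneous_def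
    proof (intro allI impI)
      fix H K :: "'a pair_pre_digraph" and f
      assume a: "induced_subgraph (with_proj H) (with_proj M) \<and> finite (pverts H) \<and>
        induced_subgraph (with_proj K) (with_proj M) \<and> finite (pverts K) \<and>
        pair_isomorphism H K f"
      then have bij: "bij_betw f (pverts H) (pverts K)"
        by (simp add: pair_isomorphism_def)
      then have im: "f ` pverts H = pverts K" "inj_on f (pverts H)"
        by (auto simp: bij_betw_def)
      have H: "pverts H \<subseteq> pverts M" "parcs H = parcs M \<inter> pverts H \<times> pverts H"
        and K: "pverts K \<subseteq> pverts M" "parcs K = parcs M \<inter> pverts K \<times> pverts K"
        using a by (simp_all add: ind)
      have "(f x, f y) \<in> parcs M \<longleftrightarrow> (x, y) \<in> parcs M" if "x \<in> pverts H" "y \<in> pverts H" for x y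
      proof -
        have "(f x, f y) \<in> parcs K \<longleftrightarrow> (x, y) \<in> parcs H"
          using a that by (simp add: pair_isomorphism_def)
        moreover have "f x \<in> pverts K" "f y \<in> pverts K" using that im by auto
        ultimately show ?thesis using that by (simp add: H(2) K(2))
      qed
      then show "\<exists>g. pair_isomorphism M M g \<and> (\<forall>x\<in>pverts H. g x = f x)"
        using R[rule_format, of "pverts H" f] im H K a by blast
    qed
  qed
qed

lemma pair_isomorphism_id: "pair_isomorphism M M id"
  by (simp add: pair_isomorphism_def)

lemma pair_isomorphism_comp:
  assumes "pair_isomorphism G H f" "pair_isomorphism H K g"
  shows "pair_isomorphism G K (\<lambda>x. g (f x))"
proof -
  have "f x \<in> pverts H" if "x \<in> pverts G" for x
    using assms(1) that by (auto simp: pair_isomorphism_def bij_betw_def)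
  then show ?thesis
    using assms bij_betw_trans[of f "pverts G" "pverts H" g "pverts K"]
    by (auto simp: pair_isomorphism_def comp_def)
qed

text \<open>A finite partial automorphism extends as soon as its domain can be enlarged one point at a
  time up to an automorphism; correcting an automorphism by a pointwise stabiliser, rather than
  doing back-and-forth, also covers uncountable digraphs.\<close>

lemma ultrahomogeneous_if_stabilisers_transitive:
  assumes "pair_wf_digraph M"
    and loopfree: "\<And>x. (x, x) \<notin> parcs M"
    and stab: "\<And>U s t. \<lbrakk>finite U; U \<subseteq> pverts M; s \<in> pverts M - U; t \<in> pverts M - U; s \<noteq> t;
      \<forall>u\<in>U. ((u, s) \<in> parcs M \<longleftrightarrow> (u, t) \<in> parcs M) \<and> ((s, u) \<in> parcs M \<longleftrightarrow> (t, u) \<in> parcs M)\<rbrakk>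
      \<Longrightarrow> \<exists>h. pair_isomorphism M M h \<and> (\<forall>u\<in>U. h u = u) \<and> h s = t"
  shows "ultrahomogeneous M"
  unfolding ultrahomogeneous_iff[OF assms(1)]
proof (intro allI impI)
  fix S and p :: "'a \<Rightarrow> 'a"
  assume "finite S" "S \<subseteq> pverts M" "inj_on p S" "p ` S \<subseteq> pverts M"
    "\<forall>x\<in>S. \<forall>y\<in>S. (p x, p y) \<in> parcs M \<longleftrightarrow> (x, y) \<in> parcs M"
  then show "\<exists>g. pair_isomorphism M M g \<and> (\<forall>x\<in>S. g x = p x)"
  proof (induction S rule: finite_induct)
    case empty
    show ?case using pair_isomorphism_id by blast
  next
    case (insert s S)
    then obtain g where g: "pair_isomorphism M M g" "\<forall>x\<in>S. g x = p x"
      by auto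
    then have bij: "bij_betw g (pverts M) (pverts M)"
      and arc: "\<And>x y. x \<in> pverts M \<Longrightarrow> y \<in> pverts M \<Longrightarrow> (g x, g y) \<in> parcs M \<longleftrightarrow> (x, y) \<in> parcs M"
      by (auto simp: pair_isomorphism_def)
    have gs: "g s \<in> pverts M" using bij insert.prems by (auto simp: bij_betw_def)
    show ?case
    proof (cases "g s = p s")
      case True
      then show ?thesis using g by auto
    next
      case False
      have "g s \<notin> p ` S"
      proof
        assume "g s \<in> p ` S"
        then obtain x where "x \<in> S" "g s = g x" using g by auto
        then show False using bij insert by (auto simp: bij_betw_def inj_on_def)
      qed
      \<comment> \<open>As \<open>g\<close> is an automorphism agreeing with \<open>p\<close> on
        \<open>S\<close>, the point \<open>g s\<close> has the same arcs to the image of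
        \<open>S\<close> as \<open>p s\<close>. This is the premise of \<open>stab\<close> with that
        image as \<open>U\<close>.\<close>
      moreover have "((p x, g s) \<in> parcs M \<longleftrightarrow> (p x, p s) \<in> parcs M) \<and>
          ((g s, p x) \<in> parcs M \<longleftrightarrow> (p s, p x) \<in> parcs M)" if "x \<in> S" for x
        using arc[of s x] arc[of x s] that insert.prems(1,4) subsetD[of S "pverts M" x] g(2) by simp
      ultimately obtain h where h: "pair_isomorphism M M h" "\<forall>u\<in>p ` S. h u = u" "h (g s) = p s"
        using stab[of "p ` S" "g s" "p s"] insert gs False by auto
      show ?thesis
        using pair_isomorphism_comp[OF g(1) h(1)] h g by (intro exI[of _ "\<lambda>x. h (g x)"]) auto
    qed
  qed
qed

section \<open>Graphs of functions and points of equal period\<close>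

definition fun_graph :: "'a set \<Rightarrow> ('a \<Rightarrow> 'a) \<Rightarrow> 'a pair_pre_digraph" where
  "fun_graph V f = \<lparr>pverts = V, parcs = {(x, f x) | x. x \<in> V}\<rparr>"

lemma fun_graph_simps [simp]:
  "pverts (fun_graph V f) = V"
  "(x, y) \<in> parcs (fun_graph V f) \<longleftrightarrow> x \<in> V \<and> y = f x"
  by (auto simp: fun_graph_def)

lemma pair_wf_fun_graph: "f \<in> V \<rightarrow> V \<Longrightarrow> pair_wf_digraph (fun_graph V f)"
  by (auto simp: pair_wf_digraph_def)

text \<open>Each vertex has exactly one outgoing arc, so commuting with \<open>f\<close> preserves
  arcs, and injectivity of \<open>g\<close> makes it reflect them.\<close>

lemma pair_isomorphism_fun_graph_iff:
  assumes "f \<in> V \<rightarrow> V"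
  shows "pair_isomorphism (fun_graph V f) (fun_graph V f) g \<longleftrightarrow>
    bij_betw g V V \<and> (\<forall>x\<in>V. g (f x) = f (g x))"
proof
  assume L: "pair_isomorphism (fun_graph V f) (fun_graph V f) g"
  have "g (f x) = f (g x)" if "x \<in> V" for x
    using L that assms by (auto simp: pair_isomorphism_def)
  then show "bij_betw g V V \<and> (\<forall>x\<in>V. g (f x) = f (g x))"
    using L by (simp add: pair_isomorphism_def)
next
  assume R: "bij_betw g V V \<and> (\<forall>x\<in>V. g (f x) = f (g x))"
  have "g x \<in> V \<and> g y = f (g x) \<longleftrightarrow> y = f x" if "x \<in> V" "y \<in> V" for x y
  proof -
    have "g x \<in> V" "f x \<in> V" using R assms that by (auto simp: bij_betw_def)
    then show ?thesis
      using R that inj_on_eq_iff[of g V y "f x"] by (simp add: bij_betw_def)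
  qed
  then show "pair_isomorphism (fun_graph V f) (fun_graph V f) g"
    using R by (simp add: pair_isomorphism_def)
qed

text \<open>Every point has least period \<open>n\<close>: \<open>V\<close> is a disjoint union of
  \<open>n\<close>-cycles, their number left open. For \<open>n = 0\<close> the condition on
  iterates is vacuous, hence the hypothesis \<open>0 < n\<close> in places below.\<close>

definition uniform_cycles :: "nat \<Rightarrow> 'a set \<Rightarrow> ('a \<Rightarrow> 'a) \<Rightarrow> bool" where
  "uniform_cycles n V f \<longleftrightarrow>
     f \<in> V \<rightarrow> V \<and> (\<forall>x\<in>V. (f ^^ n) x = x \<and> (\<forall>k. 0 < k \<longrightarrow> k < n \<longrightarrow> (f ^^ k) x \<noteq> x))"

lemma funpow_in: "f \<in> V \<rightarrow> V \<Longrightarrow> x \<in> V \<Longrightarrow> (f ^^ k) x \<in> V"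
  by (induction k) auto

text \<open>The iterate of order \<open>n - 1\<close> is a left inverse of \<open>f\<close> on
  \<open>V\<close>.\<close>

lemma uniform_cycles_inj_on:
  assumes "uniform_cycles n V f" "0 < n"
  shows "inj_on f V"
proof (rule inj_onI)
  fix x y assume xy: "x \<in> V" "y \<in> V" "f x = f y"
  obtain m where "n = Suc m" using assms(2) by (cases n) auto
  then have "(f ^^ m) (f z) = z" if "z \<in> V" for z
    using assms(1) that by (auto simp: uniform_cycles_def funpow_Suc_right simp del: funpow.simps)
  then show "x = y" by (metis xy)
qed

lemma uniform_cycles_2:
  "uniform_cycles 2 V f \<longleftrightarrow> f \<in> V \<rightarrow> V \<and> (\<forall>x\<in>V. f (f x) = x \<and> f x \<noteq> x)"
proof -
  have "(\<forall>k. 0 < k \<longrightarrow> k < 2 \<longrightarrow> P k) \<longleftrightarrow> P 1" for P :: "nat \<Rightarrow> bool"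
    by (auto simp: numeral_2_eq_2 less_Suc_eq)
  then show ?thesis by (simp add: uniform_cycles_def numeral_2_eq_2)
qed

lemma uniform_cycles_3:
  "uniform_cycles 3 V f \<longleftrightarrow>
    f \<in> V \<rightarrow> V \<and> (\<forall>x\<in>V. f (f (f x)) = x \<and> f x \<noteq> x \<and> f (f x) \<noteq> x)"
proof -
  have "(\<forall>k. 0 < k \<longrightarrow> k < Suc (Suc (Suc 0)) \<longrightarrow> P k) \<longleftrightarrow> P 1 \<and> P 2" for P :: "nat \<Rightarrow> bool"
    by (auto simp: less_Suc_eq numeral_2_eq_2)
  then show ?thesis by (simp add: uniform_cycles_def numeral_3_eq_3) (simp add: numeral_2_eq_2)
qed

lemma uniform_cycles_4:
  "uniform_cycles 4 V f \<longleftrightarrow>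
    f \<in> V \<rightarrow> V \<and>
    (\<forall>x\<in>V. f (f (f (f x))) = x \<and> f x \<noteq> x \<and> f (f x) \<noteq> x \<and> f (f (f x)) \<noteq> x)"
proof -
  have four: "4 = Suc (Suc (Suc (Suc 0)))" by simp
  have "(\<forall>k. 0 < k \<longrightarrow> k < 4 \<longrightarrow> P k) \<longleftrightarrow> P (Suc 0) \<and> P (Suc (Suc 0)) \<and> P (Suc (Suc (Suc 0)))" for P :: "nat \<Rightarrow> bool"
    by (auto simp: less_Suc_eq four)
  then show ?thesis by (simp add: uniform_cycles_def) (simp add: four)
qed

section \<open>Ultrahomogeneity of the listed digraphs\<close>

text \<open>Lengths 2 and 3 share one proof because in both any two points of a cycle are adjacent,
  and \<open>{x, f x, f (f x)}\<close> is the whole cycle of \<open>x\<close>, with a repeated entry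
  for length 2.\<close>

lemma ultrahomogeneous_cycles_2_3:
  assumes "uniform_cycles 2 V f \<or> uniform_cycles 3 V f"
  shows "ultrahomogeneous (fun_graph V f)"
proof -
  have f: "f \<in> V \<rightarrow> V" and inj: "inj_on f V" and ne: "\<And>x. x \<in> V \<Longrightarrow> f x \<noteq> x"
    using assms uniform_cycles_inj_on[of 2 V f] uniform_cycles_inj_on[of 3 V f]
    by (auto simp: uniform_cycles_2 uniform_cycles_3)
  have fV [simp]: "f x \<in> V" if "x \<in> V" for x using f that by auto
  have cyc: "(\<forall>x\<in>V. f (f x) = x) \<or> (\<forall>x\<in>V. f (f (f x)) = x \<and> f (f x) \<noteq> x)"
    using assms by (auto simp: uniform_cycles_2 uniform_cycles_3)
  define orb where "orb x = {x, f x, f (f x)}" for x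
  have orb_sub: "orb x \<subseteq> V" if "x \<in> V" for x using that by (auto simp: orb_def)
  have orb_f: "f y \<in> orb x \<longleftrightarrow> y \<in> orb x" if "x \<in> V" "y \<in> V" for x y
    using cyc that unfolding orb_def by (smt (verit) fV insert_iff empty_iff inj inj_on_eq_iff)
  show ?thesis
  proof (rule ultrahomogeneous_if_stabilisers_transitive)
    show "pair_wf_digraph (fun_graph V f)" using f by (rule pair_wf_fun_graph)
    show "(x, x) \<notin> parcs (fun_graph V f)" for x using ne[of x] by auto
    fix U s t
    assume U: "U \<subseteq> pverts (fun_graph V f)" and s: "s \<in> pverts (fun_graph V f) - U"
      and t: "t \<in> pverts (fun_graph V f) - U" and st: "s \<noteq> t"
      and adj: "\<forall>u\<in>U. ((u, s) \<in> parcs (fun_graph V f) \<longleftrightarrow> (u, t) \<in> parcs (fun_graph V f)) \<and>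
        ((s, u) \<in> parcs (fun_graph V f) \<longleftrightarrow> (t, u) \<in> parcs (fun_graph V f))"
    have sV: "s \<in> V" "s \<notin> U" and tV: "t \<in> V" "t \<notin> U" using s t by auto
    have "u \<notin> orb s \<and> u \<notin> orb t" if "u \<in> U" for u
    proof -
      have "u \<in> V" using U that by auto
      moreover have "s = f u \<longleftrightarrow> t = f u" "u = f s \<longleftrightarrow> u = f t"
        using adj that sV tV \<open>u \<in> V\<close> by auto
      then have "s \<noteq> f u" "t \<noteq> f u" "u \<noteq> f s" "u \<noteq> f t"
        using st inj_onD[OF inj, of s t] sV tV by auto
      ultimately show ?thesis
        using cyc sV tV that by (auto simp: orb_def)
    qed
    then have fix_U: "\<And>u. u \<in> U \<Longrightarrow> u \<notin> orb s" "\<And>u. u \<in> U \<Longrightarrow> u \<notin> orb t" by auto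
    show "\<exists>h. pair_isomorphism (fun_graph V f) (fun_graph V f) h \<and> (\<forall>u\<in>U. h u = u) \<and> h s = t"
    proof (cases "t \<in> orb s")
      case True
      have "\<exists>h. pair_isomorphism (fun_graph V f) (fun_graph V f) h \<and> (\<forall>u\<in>U. h u = u) \<and> h s = f s"
      proof (intro exI conjI)
        \<comment> \<open>Turn the cycle of \<open>s\<close> by one step and fix all other vertices.
          By \<open>orb_f\<close>, membership in this cycle is invariant under \<open>f\<close>, so
          the map commutes with \<open>f\<close>.\<close>
        let ?h = "\<lambda>x. if x \<in> orb s then f x else x"
        show "pair_isomorphism (fun_graph V f) (fun_graph V f) ?h"
          unfolding pair_isomorphism_fun_graph_iff[OF f]
        proof
          show "\<forall>x\<in>V. ?h (f x) = f (?h x)" using orb_f sV by auto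
          have "inj_on ?h V"
            using orb_f[OF sV(1)] inj unfolding inj_on_def by (smt (verit))
          moreover have "?h ` V = V"
          proof
            show "?h ` V \<subseteq> V" by auto
            show "V \<subseteq> ?h ` V"
            proof
              fix y assume y: "y \<in> V"
              show "y \<in> ?h ` V"
              proof (cases "y \<in> orb s")
                case False
                then show ?thesis using y by (intro image_eqI[of _ _ y]) auto
              next
                case True
                have "f (f y) = y \<or> f (f (f y)) = y" using cyc y by auto
                then obtain z where z: "z \<in> V" "f z = y" using y fV by metis
                then show ?thesis using True orb_f[OF sV(1)] by (intro image_eqI[of _ _ z]) auto
              qed
            qed
          qed
          ultimately show "bij_betw ?h V V" by (simp add: bij_betw_def)
        qed
        show "\<forall>u\<in>U. ?h u = u" using fix_U by auto
        show "?h s = f s" by (simp add: orb_def)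
      qed
      then obtain h where h: "pair_isomorphism (fun_graph V f) (fun_graph V f) h"
        "\<forall>u\<in>U. h u = u" "h s = f s" by blast
      consider "t = f s" | "t = f (f s)" using True st by (auto simp: orb_def)
      then show ?thesis
      proof cases
        case 1
        then show ?thesis using h by blast
      next
        case 2
        have "h (f s) = f (h s)" using h(1) sV by (simp add: pair_isomorphism_fun_graph_iff[OF f])
        then show ?thesis
          using pair_isomorphism_comp[OF h(1) h(1)] h 2 by (intro exI[of _ "\<lambda>x. h (h x)"]) auto
      qed
    next
      case False
      \<comment> \<open>Exchange the cycles of \<open>s\<close> and \<open>t\<close> position by
        position. Overlapping tests are harmless: for length 2, \<open>f (f s) = s\<close> and
        \<open>f (f t) = t\<close> give the same values under either test.\<close>
      define h where "h x = (if x = s then t else if x = f s then f t else if x = f (f s) then f (f t)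
        else if x = t then s else if x = f t then f s else if x = f (f t) then f (f s) else x)" for x
      \<comment> \<open>Disjointness of the two cycles, which makes \<open>h\<close> an involution
        and hence a bijection.\<close>
      have dist: "s \<noteq> f t" "s \<noteq> f (f t)" "f s \<noteq> t" "f s \<noteq> f t" "f s \<noteq> f (f t)"
        "f (f s) \<noteq> t" "f (f s) \<noteq> f t" "f (f s) \<noteq> f (f t)"
        using False st sV(1) tV(1) cyc inj_on_eq_iff[OF inj] unfolding orb_def
        by (metis fV insertI1 insertI2)+
      have hV: "h x \<in> V" if "x \<in> V" for x using that sV tV by (simp add: h_def)
      have hh: "h (h x) = x" if "x \<in> V" for x
        using dist dist[symmetric] st st[symmetric] cyc sV tV ne ne[THEN not_sym] by (auto simp: h_def)
      have hf: "h (f x) = f (h x)" if "x \<in> V" for x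
      proof -
        have eq: "f x = f y \<longleftrightarrow> x = y" if "y \<in> V" for y
          using inj_on_eq_iff[OF inj] \<open>x \<in> V\<close> that by auto
        from cyc show ?thesis
        proof
          assume c: "\<forall>x\<in>V. f (f x) = x"
          have "f x = s \<longleftrightarrow> x = f s" "f x = t \<longleftrightarrow> x = f t" using c that sV tV by auto
          then show ?thesis
            using dist dist[symmetric] st st[symmetric] c sV tV that eq ne ne[THEN not_sym] by (auto simp: h_def)
        next
          assume c: "\<forall>x\<in>V. f (f (f x)) = x \<and> f (f x) \<noteq> x"
          have "f x = s \<longleftrightarrow> x = f (f s)" "f x = t \<longleftrightarrow> x = f (f t)" using c that sV tV by auto
          then show ?thesis
            using dist dist[symmetric] st st[symmetric] c sV tV that eq ne ne[THEN not_sym] by (auto simp: h_def)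
        qed
      qed
      have "bij_betw h V V" by (rule bij_betw_byWitness[of _ h]) (use hh hV in auto)
      moreover have "\<forall>u\<in>U. h u = u" using fix_U by (auto simp: h_def orb_def)
      moreover have "h s = t" by (simp add: h_def)
      ultimately show ?thesis using hf by (auto simp: pair_isomorphism_fun_graph_iff[OF f])
    qed
  qed
qed

lemma uniform_cycles_4_card_orbit:
  assumes "uniform_cycles 4 V f" "x \<in> V"
  shows "card {x, f x, f (f x), f (f (f x))} = 4"
proof -
  have "f x \<in> V" "f (f x) \<in> V" using assms by (auto simp: uniform_cycles_4)
  then have "f x \<noteq> x" "f (f x) \<noteq> x" "f (f (f x)) \<noteq> x" "f (f x) \<noteq> f x" "f (f (f x)) \<noteq> f x"
    "f (f (f x)) \<noteq> f (f x)"
    using assms by (auto simp: uniform_cycles_4)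
  then show ?thesis by (auto simp: card_insert_if)
qed

text \<open>A nonempty \<open>U\<close> admits no distinct \<open>s\<close> and \<open>t\<close>, so
  only transitivity on vertices is left, and powers of \<open>f\<close> provide it.\<close>

lemma ultrahomogeneous_single_4_cycle:
  assumes cyc: "uniform_cycles 4 V f" and card: "card V = 4"
  shows "ultrahomogeneous (fun_graph V f)"
proof -
  have f: "f \<in> V \<rightarrow> V" and inj: "inj_on f V"
    using cyc uniform_cycles_inj_on[of 4 V f] by (auto simp: uniform_cycles_def)
  have V: "V = {x, f x, f (f x), f (f (f x))}" if "x \<in> V" for x
  proof -
    have "{x, f x, f (f x), f (f (f x))} \<subseteq> V" using f that by auto
    moreover have "finite V" using card by (simp add: card_ge_0_finite)
    ultimately show ?thesis
      using card_subset_eq uniform_cycles_4_card_orbit[OF cyc that] card by metis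
  qed
  have aut: "pair_isomorphism (fun_graph V f) (fun_graph V f) (f ^^ k)" for k
  proof (induction k)
    case 0
    show ?case by (simp add: pair_isomorphism_def bij_betw_def)
  next
    case (Suc k)
    have "f ` V = V"
      using f inj card by (intro endo_inj_surj) (auto simp: card_ge_0_finite)
    then have "pair_isomorphism (fun_graph V f) (fun_graph V f) f"
      using inj by (simp add: pair_isomorphism_fun_graph_iff[OF f] bij_betw_def)
    then show ?case using pair_isomorphism_comp[OF Suc] by (simp add: comp_def)
  qed
  show ?thesis
  proof (rule ultrahomogeneous_if_stabilisers_transitive)
    show "pair_wf_digraph (fun_graph V f)" using f by (rule pair_wf_fun_graph)
    show "(x, x) \<notin> parcs (fun_graph V f)" for x using cyc by (auto simp: uniform_cycles_4)
    fix U s t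
    assume U: "U \<subseteq> pverts (fun_graph V f)" and s: "s \<in> pverts (fun_graph V f) - U"
      and t: "t \<in> pverts (fun_graph V f) - U" and st: "s \<noteq> t"
      and adj: "\<forall>u\<in>U. ((u, s) \<in> parcs (fun_graph V f) \<longleftrightarrow> (u, t) \<in> parcs (fun_graph V f)) \<and>
        ((s, u) \<in> parcs (fun_graph V f) \<longleftrightarrow> (t, u) \<in> parcs (fun_graph V f))"
    have "False" if "u \<in> U" for u
    proof -
      have uV: "u \<in> V" using U that by auto
      have st': "s \<in> V" "t \<in> V" "s \<noteq> u" "t \<noteq> u" using s t that by auto
      have adj': "s = f u \<longleftrightarrow> t = f u" "u = f s \<longleftrightarrow> u = f t"
        using adj that st' uV by auto
      \<comment> \<open>This identifies \<open>f (f (f u))\<close> as the preimage of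
        \<open>u\<close>. By \<open>adj'\<close>, neither \<open>s\<close> nor \<open>t\<close> can
        be this point or \<open>f u\<close>, so both would equal \<open>f (f u)\<close>.\<close>
      have "f (f (f (f u))) = u" using cyc uV by (auto simp: uniform_cycles_4)
      then show False
        using V[OF uV] st' st adj' inj_onD[OF inj, of s t] by (metis insert_iff empty_iff)
    qed
    then have "U = {}" by blast
    moreover have "\<exists>k. (f ^^ k) s = t"
    proof -
      have "t \<in> {s, f s, f (f s), f (f (f s))}" using V[of s] s t by simp
      then have "t = (f ^^ 0) s \<or> t = (f ^^ 1) s \<or> t = (f ^^ 2) s \<or> t = (f ^^ 3) s"
        by (simp add: numeral_2_eq_2 numeral_3_eq_3)
      then show ?thesis by metis
    qed
    ultimately show "\<exists>h. pair_isomorphism (fun_graph V f) (fun_graph V f) h \<and>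
        (\<forall>u\<in>U. h u = u) \<and> h s = t"
      using aut by blast
  qed
qed

text \<open>Without arcs every permutation of the vertices is an automorphism, in particular a
  transposition.\<close>

lemma ultrahomogeneous_arcless:
  assumes "parcs M = {}"
  shows "ultrahomogeneous M"
proof (rule ultrahomogeneous_if_stabilisers_transitive)
  show "pair_wf_digraph M" using assms by (simp add: pair_wf_digraph_def)
  show "(x, x) \<notin> parcs M" for x using assms by simp
  fix U s t
  assume "s \<in> pverts M - U" "t \<in> pverts M - U"
  then have "pair_isomorphism M M (transpose s t) \<and> (\<forall>u\<in>U. transpose s t u = u) \<and>
      transpose s t s = t"
    using assms by (auto simp: pair_isomorphism_def transpose_def bij_betw_def inj_on_def image_def)
  then show "\<exists>h. pair_isomorphism M M h \<and> (\<forall>u\<in>U. h u = u) \<and> h s = t" by blast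
qed

section \<open>Ultrahomogeneous graphs of functions\<close>

text \<open>If \<open>f\<close> has neither 2-cycles nor 3-cycles, then \<open>x\<close> and \<open>f (f x)\<close> are independent, and the
  automorphism swapping them forces \<open>f\<^sup>4 = id\<close>; a point \<open>w\<close> off the cycle of \<open>x\<close> is then
  independent of \<open>x\<close> as well, but an automorphism fixing \<open>x\<close> fixes \<open>f (f x)\<close>.\<close>

lemma ultrahomogeneous_fun_graph_cycles:
  assumes uh: "ultrahomogeneous (fun_graph V f)" and f: "f \<in> V \<rightarrow> V"
    and ne: "\<And>x. x \<in> V \<Longrightarrow> f x \<noteq> x" and "V \<noteq> {}"
  shows "uniform_cycles 2 V f \<or> uniform_cycles 3 V f \<or> uniform_cycles 4 V f \<and> card V = 4"
proof -
  have fV [simp]: "f x \<in> V" if "x \<in> V" for x using f that by auto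
  note ext = uh[unfolded ultrahomogeneous_iff[OF pair_wf_fun_graph[OF f]]
      pair_isomorphism_fun_graph_iff[OF f] fun_graph_simps, rule_format]
  \<comment> \<open>Loops being absent, every map between one-point sets is a partial
    isomorphism.\<close>
  have point: "\<exists>g. bij_betw g V V \<and> (\<forall>x\<in>V. g (f x) = f (g x)) \<and> g x = y"
    if "x \<in> V" "y \<in> V" for x y
    using ext[of "{x}" "\<lambda>_. y"] that ne[THEN not_sym] by auto
  \<comment> \<open>Both pairs are independent, so there are no arcs to match.\<close>
  have pair: "\<exists>g. bij_betw g V V \<and> (\<forall>x\<in>V. g (f x) = f (g x)) \<and> g x = x' \<and> g y = y'"
    if "x \<in> V" "y \<in> V" "x \<noteq> y" "f x \<noteq> y" "f y \<noteq> x"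
      "x' \<in> V" "y' \<in> V" "x' \<noteq> y'" "f x' \<noteq> y'" "f y' \<noteq> x'" for x y x' y'
  proof -
    have "\<exists>g. (bij_betw g V V \<and> (\<forall>x\<in>V. g (f x) = f (g x))) \<and>
        (\<forall>z\<in>{x, y}. g z = (if z = x then x' else y'))"
      by (rule ext) (use that ne[THEN not_sym] in \<open>auto simp: inj_on_def split: if_splits\<close>)
    then show ?thesis using \<open>x \<noteq> y\<close> by auto
  qed
  obtain x0 where x0: "x0 \<in> V" using \<open>V \<noteq> {}\<close> by blast
  \<comment> \<open>The second premise says that \<open>P\<close> depends only on which arguments
    are equal. An automorphism taking \<open>x0\<close> to \<open>y\<close> then carries
    \<open>P\<close> over, so the period found at \<open>x0\<close> spreads to all of
    \<open>V\<close>. The last argument \<open>d\<close> is the point itself, the others are its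
    first three iterates.\<close>
  have hom: "P (f y) (f (f y)) (f (f (f y))) y \<longleftrightarrow> P (f x0) (f (f x0)) (f (f (f x0))) x0"
    if "y \<in> V" and P: "\<And>g a b c d. inj_on g V \<Longrightarrow> {a,b,c,d} \<subseteq> V \<Longrightarrow> P (g a) (g b) (g c) (g d) \<longleftrightarrow> P a b c d" for P y
  proof -
    obtain g where g: "bij_betw g V V" "\<And>x. x \<in> V \<Longrightarrow> g (f x) = f (g x)" "g x0 = y"
      using point[OF x0 \<open>y \<in> V\<close>] by blast
    then have "g (f x0) = f y" "g (f (f x0)) = f (f y)" "g (f (f (f x0))) = f (f (f y))"
      using x0 by auto
    moreover have "P (g (f x0)) (g (f (f x0))) (g (f (f (f x0)))) (g x0) \<longleftrightarrow>
        P (f x0) (f (f x0)) (f (f (f x0))) x0"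
      using g(1) x0 by (intro P) (auto simp: bij_betw_def)
    ultimately show ?thesis using g(3) by simp
  qed
  consider "f (f x0) = x0" | "f (f x0) \<noteq> x0" "f (f (f x0)) = x0"
    | "f (f x0) \<noteq> x0" "f (f (f x0)) \<noteq> x0" by blast
  then show ?thesis
  proof cases
    case 1
    then have "f (f y) = y" if "y \<in> V" for y
      using hom[of y "\<lambda>a b c d. b = d"] that by (auto simp: inj_on_eq_iff)
    then show ?thesis using f ne by (simp add: uniform_cycles_2)
  next
    case 2
    then have "f (f y) \<noteq> y \<and> f (f (f y)) = y" if "y \<in> V" for y
      using hom[of y "\<lambda>a b c d. b \<noteq> d \<and> c = d"] that by (auto simp: inj_on_eq_iff)
    then show ?thesis using f ne by (simp add: uniform_cycles_3)
  next
    case 3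
    then have n3: "f (f y) \<noteq> y \<and> f (f (f y)) \<noteq> y" if "y \<in> V" for y
      using hom[of y "\<lambda>a b c d. b \<noteq> d \<and> c \<noteq> d"] that by (auto simp: inj_on_eq_iff)
    have f4: "f (f (f (f x))) = x" if "x \<in> V" for x
    proof -
      have "f x \<noteq> f (f x)" using ne[of "f x"] that by auto
      then have "\<exists>g. bij_betw g V V \<and> (\<forall>y\<in>V. g (f y) = f (g y)) \<and> g x = f (f x) \<and> g (f (f x)) = x"
        using n3[OF that] that by (intro pair) auto
      then obtain g where g: "\<And>y. y \<in> V \<Longrightarrow> g (f y) = f (g y)" "g x = f (f x)" "g (f (f x)) = x"
        by blast
      have "x = f (f (g x))" using g(1)[of x] g(1)[of "f x"] g(3) that by simp
      then show ?thesis by (simp add: g(2))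
    qed
    have cyc: "uniform_cycles 4 V f" using f ne n3 f4 by (simp add: uniform_cycles_4)
    have "w \<in> {x0, f x0, f (f x0), f (f (f x0))}" if w: "w \<in> V" for w
    proof (rule ccontr)
      assume *: "w \<notin> {x0, f x0, f (f x0), f (f (f x0))}"
      \<comment> \<open>Otherwise \<open>w = f (f (f (f w))) = f (f (f x0))\<close> would lie on the
        cycle of \<open>x0\<close>.\<close>
      then have "f w \<noteq> x0" using f4[OF w] by auto
      moreover have "f x0 \<noteq> f (f x0)" using ne[of "f x0"] x0 by auto
      ultimately have "\<exists>g. bij_betw g V V \<and> (\<forall>y\<in>V. g (f y) = f (g y)) \<and> g x0 = x0 \<and> g (f (f x0)) = w"
        using n3[OF x0] x0 w * by (intro pair) auto
      then obtain g where g: "\<And>y. y \<in> V \<Longrightarrow> g (f y) = f (g y)" "g x0 = x0" "g (f (f x0)) = w"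
        by blast
      have "w = f (f x0)" using g(1)[of x0] g(1)[of "f x0"] g(2,3) x0 by simp
      then show False using * by simp
    qed
    then have "V = {x0, f x0, f (f x0), f (f (f x0))}" using x0 by auto
    then have "card V = 4" using uniform_cycles_4_card_orbit[OF cyc x0] by simp
    then show ?thesis using cyc by simp
  qed
qed

section \<open>Translation between equal periods and copies of cycle algebras\<close>

text \<open>Under the isomorphism the index stays put and the second coordinate advances by one
  modulo \<open>n\<close>, so every point first returns to itself after \<open>n\<close>
  steps.\<close>

lemma pm_isomorphic_copies_cycle_imp:
  assumes A: "partial_monounary_algebra A"
    and iso: "pm_isomorphic A (copies I (cycle_algebra n))"
  shows "dom (pm_op A) = pm_carrier A" "uniform_cycles n (pm_carrier A) (the \<circ> pm_op A)"
proof -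
  let ?C = "copies I (cycle_algebra n)" 
  define f where "f = the \<circ> pm_op A"
  obtain F where F: "pm_isomorphism A ?C F" using iso by (auto simp: pm_isomorphic_def)
  have C: "pm_carrier ?C = I \<times> {0..<n}" "dom (pm_op ?C) = I \<times> {0..<n}"
    and op: "\<And>i k. i \<in> I \<Longrightarrow> k < n \<Longrightarrow> pm_op ?C (i, k) = Some (i, (k + 1) mod n)"
    by (auto simp: copies_def cycle_algebra_def dom_def split: if_splits)
  have bij: "bij_betw F (pm_carrier A) (I \<times> {0..<n})"
    using F by (simp add: pm_isomorphism_def C)
  then have FA: "F x \<in> I \<times> {0..<n}" if "x \<in> pm_carrier A" for x
    using that by (auto simp: bij_betw_def)
  show dom: "dom (pm_op A) = pm_carrier A"
    using F FA A by (auto simp: pm_isomorphism_def C(2) partial_monounary_algebra_def)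
  have f: "f \<in> pm_carrier A \<rightarrow> pm_carrier A"
  proof
    fix x assume "x \<in> pm_carrier A"
    then obtain y where "pm_op A x = Some y" using dom by blast
    then show "f x \<in> pm_carrier A"
      using A by (auto simp: partial_monounary_algebra_def f_def intro: ranI)
  qed
  have step: "F (f x) = (fst (F x), Suc (snd (F x)) mod n)" if "x \<in> pm_carrier A" for x
  proof -
    have "F (f x) = the (pm_op ?C (F x))"
      using F that dom by (simp add: pm_isomorphism_def f_def)
    then show ?thesis using FA[OF that] op by (cases "F x") (auto simp: f_def)
  qed
  have pow: "F ((f ^^ k) x) = (fst (F x), (snd (F x) + k) mod n)" if "x \<in> pm_carrier A" for k x
  proof (induction k)
    case 0
    show ?case using FA[OF that] by (cases "F x") auto
  next
    case (Suc k)
    then show ?case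
      using step[OF funpow_in[OF f that, of k]] by (simp add: mod_Suc_eq)
  qed
  have eq: "(f ^^ k) x = x \<longleftrightarrow> (snd (F x) + k) mod n = snd (F x)" if "x \<in> pm_carrier A" for k x
  proof -
    have "(f ^^ k) x = x \<longleftrightarrow> F ((f ^^ k) x) = F x"
      using bij that funpow_in[OF f that] by (metis bij_betw_def inj_on_eq_iff)
    then show ?thesis by (auto simp: pow[OF that] prod_eq_iff)
  qed
  show "uniform_cycles n (pm_carrier A) (the \<circ> pm_op A)"
    unfolding uniform_cycles_def f_def[symmetric]
  proof (intro conjI ballI allI impI f)
    fix x assume x: "x \<in> pm_carrier A"
    then have lt: "snd (F x) < n" using FA by fastforce
    then show "(f ^^ n) x = x" by (simp add: eq[OF x])
    fix k assume "0 < k" "k < n"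
    \<comment> \<open>Adding \<open>k\<close> either stays below \<open>n\<close> and exceeds the
      starting value, or wraps around and, since \<open>k < n\<close>, ends below it.\<close>
    then show "(f ^^ k) x \<noteq> x"
      using lt by (cases "snd (F x) + k < n") (auto simp: eq[OF x] mod_if)
  qed
qed

text \<open>One point chosen on each cycle gives the index set, which is why it can live in the type
  of \<open>A\<close> itself. The second coordinate counts steps from the chosen point.\<close>

lemma pm_isomorphic_copies_cycleI:
  fixes A :: "'a pm_algebra"
  assumes dom: "dom (pm_op A) = pm_carrier A"
    and cyc: "uniform_cycles n (pm_carrier A) (the \<circ> pm_op A)" and "0 < n"
  shows "\<exists>I :: 'a set. pm_isomorphic A (copies I (cycle_algebra n))"
proof -
  define f where "f = the \<circ> pm_op A"
  define V where "V = pm_carrier A"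
  have f: "f \<in> V \<rightarrow> V" and per: "\<And>x. x \<in> V \<Longrightarrow> (f ^^ n) x = x"
    and min: "\<And>x k. x \<in> V \<Longrightarrow> 0 < k \<Longrightarrow> k < n \<Longrightarrow> (f ^^ k) x \<noteq> x"
    using cyc by (auto simp: uniform_cycles_def f_def V_def)
  define orb where "orb x = {(f ^^ k) x | k. True}" for x
  have orb_self: "x \<in> orb x" for x unfolding orb_def by (auto intro: exI[of _ 0])
  have orb_pow: "(f ^^ k) x \<in> orb x" for x k by (auto simp: orb_def)
  \<comment> \<open>Completing the lap undoes \<open>k\<close> steps. This makes forward orbits
    symmetric, hence classes of an equivalence.\<close>
  have return: "(f ^^ (n - k)) ((f ^^ k) x) = x" if "x \<in> V" "k \<le> n" for x k
    using per[OF that(1)] that(2) by (simp flip: funpow_add[THEN fun_cong, unfolded comp_def])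
  have small: "\<exists>k<n. y = (f ^^ k) x" if "x \<in> V" "y \<in> orb x" for x y
  proof -
    obtain m where "y = (f ^^ m) x" using \<open>y \<in> orb x\<close> by (auto simp: orb_def)
    then have "y = (f ^^ (m mod n)) x" using funpow_mod_eq[OF per[OF that(1)]] by simp
    then show ?thesis using \<open>0 < n\<close> mod_less_divisor by blast
  qed
  have sub: "orb y \<subseteq> orb x" if "y \<in> orb x" for x y
    using that unfolding orb_def by (auto simp flip: funpow_add[THEN fun_cong, unfolded comp_def])
  have sym: "x \<in> orb y" if "x \<in> V" "y \<in> orb x" for x y
    using small[OF that] return[OF that(1)] unfolding orb_def
    by (metis (mono_tags, lifting) less_imp_le mem_Collect_eq)
  have orb_eq: "orb y = orb x" if "x \<in> V" "y \<in> orb x" for x y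
    using sub that sym by blast
  \<comment> \<open>The choice depends on the set \<open>orb x\<close> alone, so all points of a
    cycle get the same representative.\<close>
  define r where "r x = (SOME y. y \<in> orb x)" for x
  have r_in: "r x \<in> orb x" for x unfolding r_def using orb_self by (rule someI)
  have orb_V: "orb x \<subseteq> V" if "x \<in> V" for x using funpow_in[OF f that] by (auto simp: orb_def)
  define I where "I = r ` V"
  have IV: "I \<subseteq> V" using r_in orb_V by (auto simp: I_def)
  have rI: "r i = i" if "i \<in> I" for i
    using that orb_eq[OF _ r_in] by (auto simp: I_def r_def)
  define G where "G = (\<lambda>(i, k). (f ^^ k) i)"
  have inj: "inj_on G (I \<times> {0..<n})"
  proof (rule inj_onI, clarsimp simp: G_def)
    fix i k j l
    assume a: "i \<in> I" "k < n" "j \<in> I" "l < n" "(f ^^ k) i = (f ^^ l) j"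
    have V: "i \<in> V" "j \<in> V" using a IV by auto
    have "orb i = orb ((f ^^ k) i)" "orb j = orb ((f ^^ l) j)"
      using orb_eq V orb_pow by metis+
    then have "orb i = orb j" using a by simp
    then have ij: "i = j" using rI a by (metis r_def)
    \<comment> \<open>Completing the lap from position \<open>l\<close> would return
      \<open>i\<close> to itself after \<open>n - l + k\<close> steps, a positive number below
      \<open>n\<close>.\<close>
    have "\<not> k < l" if "(f ^^ k) i = (f ^^ l) i" "l < n" for k l
    proof
      assume "k < l"
      then have "(f ^^ (n - l)) ((f ^^ k) i) = i" using return[OF V(1), of l] that by simp
      then have "(f ^^ (n - l + k)) i = i" by (simp add: funpow_add)
      moreover have "n - l + k < n" using \<open>k < l\<close> \<open>l < n\<close> by linarith
      ultimately show False using min[OF V(1), of "n - l + k"] \<open>l < n\<close> by simp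
    qed
    from this[of k l] this[of l k] have "k = l" using a ij by auto
    then show "i = j \<and> k = l" using ij by simp
  qed
  have "G ` (I \<times> {0..<n}) = V"
  proof
    show "G ` (I \<times> {0..<n}) \<subseteq> V" using IV funpow_in[OF f] by (auto simp: G_def)
    show "V \<subseteq> G ` (I \<times> {0..<n})"
    proof
      fix x assume x: "x \<in> V"
      then have "x \<in> orb (r x)" "r x \<in> V" using sym r_in orb_V by blast+
      then obtain k where "k < n" "x = (f ^^ k) (r x)" using small by blast
      then show "x \<in> G ` (I \<times> {0..<n})"
        using x by (intro image_eqI[of _ _ "(r x, k)"]) (auto simp: G_def I_def)
    qed
  qed
  with inj have bij: "bij_betw G (I \<times> {0..<n}) V" by (simp add: bij_betw_def)
  let ?F = "the_inv_into (I \<times> {0..<n}) G" and ?C = "copies I (cycle_algebra n)"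
  have C: "pm_carrier ?C = I \<times> {0..<n}" "dom (pm_op ?C) = I \<times> {0..<n}"
    by (auto simp: copies_def cycle_algebra_def dom_def split: if_splits)
  have F: "bij_betw ?F V (I \<times> {0..<n})" by (rule bij_betw_the_inv_into[OF bij])
  have "the (pm_op ?C (?F x)) = ?F (f x)" if "x \<in> V" for x
  proof -
    have "x \<in> G ` (I \<times> {0..<n})" using bij that by (simp add: bij_betw_def)
    then obtain i k where ik: "i \<in> I" "k < n" "x = (f ^^ k) i"
      by (auto simp: G_def)
    have "x = G (i, k)" using ik by (simp add: G_def)
    then have "?F x = (i, k)" using ik inj by (simp add: the_inv_into_f_f)
    \<comment> \<open>For \<open>k = n - 1\<close> the position wraps to 0, and periodicity of
      \<open>i\<close> accounts for it.\<close>
    moreover have "f x = G (i, (k + 1) mod n)"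
      using ik IV funpow_mod_eq[OF per, of i "k + 1"] by (auto simp: G_def)
    then have "?F (f x) = (i, (k + 1) mod n)"
      using ik inj \<open>0 < n\<close> by (simp add: the_inv_into_f_f)
    ultimately show ?thesis using ik by (simp add: copies_def cycle_algebra_def)
  qed
  moreover have "?F x \<in> I \<times> {0..<n}" if "x \<in> V" for x
    using F that by (auto simp: bij_betw_def)
  ultimately have "pm_isomorphism A ?C ?F"
    using F dom by (auto simp: pm_isomorphism_def C V_def f_def)
  then show ?thesis by (auto simp: pm_isomorphic_def)
qed

lemma pm_isomorphic_trans:
  assumes "pm_isomorphic A B" "pm_isomorphic B C" "dom (pm_op A) \<subseteq> pm_carrier A"
  shows "pm_isomorphic A C"
proof -
  obtain f g where fg: "pm_isomorphism A B f" "pm_isomorphism B C g"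
    using assms by (auto simp: pm_isomorphic_def)
  have "f x \<in> pm_carrier B" if "x \<in> pm_carrier A" for x
    using fg(1) that by (auto simp: pm_isomorphism_def bij_betw_def)
  moreover have "bij_betw (g \<circ> f) (pm_carrier A) (pm_carrier C)"
    using fg by (auto simp: pm_isomorphism_def intro: bij_betw_trans simp del: comp_apply)
  moreover have "the (pm_op C (g (f x))) = g (f (the (pm_op A x)))" if "x \<in> dom (pm_op A)" for x
  proof -
    have "f x \<in> dom (pm_op B)" "the (pm_op B (f x)) = f (the (pm_op A x))"
      using fg(1) that assms(3) unfolding pm_isomorphism_def by blast+
    then show ?thesis using fg(2) by (simp add: pm_isomorphism_def)
  qed
  ultimately have "pm_isomorphism A C (g \<circ> f)"
    using fg by (simp add: pm_isomorphism_def)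
  then show ?thesis by (auto simp: pm_isomorphic_def)
qed

text \<open>A lone cycle counts as one copy of itself, so the results on copies apply to it.\<close>

lemma pm_isomorphic_copies_singleton:
  assumes "dom (pm_op C) \<subseteq> pm_carrier C"
  shows "pm_isomorphic C (copies {u} C)" "pm_isomorphic (copies {u} C) C"
proof -
  have "pm_isomorphism C (copies {u} C) (Pair u)"
    by (auto simp: pm_isomorphism_def copies_def bij_betw_def inj_on_def dom_def)
  then show "pm_isomorphic C (copies {u} C)" by (auto simp: pm_isomorphic_def)
  have "pm_isomorphism (copies {u} C) C snd"
    using assms
    by (auto simp: pm_isomorphism_def copies_def bij_betw_def inj_on_def dom_def split: if_splits)
  then show "pm_isomorphic (copies {u} C) C" by (auto simp: pm_isomorphic_def)
qed

lemma pm_isomorphic_card: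
  "pm_isomorphic A B \<Longrightarrow> card (pm_carrier A) = card (pm_carrier B)"
  using bij_betw_same_card unfolding pm_isomorphic_def pm_isomorphism_def by metis

lemma pm_isomorphic_cycle_iff:
  assumes A: "partial_monounary_algebra A" and "0 < n"
  shows "pm_isomorphic A (cycle_algebra n) \<longleftrightarrow>
    dom (pm_op A) = pm_carrier A \<and> uniform_cycles n (pm_carrier A) (the \<circ> pm_op A) \<and>
    card (pm_carrier A) = n" (is "?L \<longleftrightarrow> ?R")
proof -
  have C: "dom (pm_op (cycle_algebra n)) \<subseteq> pm_carrier (cycle_algebra n)"
    "card (pm_carrier (cycle_algebra n)) = n"
    by (auto simp: cycle_algebra_def split: if_splits)
  have dom: "dom (pm_op A) \<subseteq> pm_carrier A"
    using A by (simp add: partial_monounary_algebra_def)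
  show ?thesis
  proof
    assume L: ?L
    have "pm_isomorphic A (copies {()} (cycle_algebra n))"
      by (rule pm_isomorphic_trans[OF L pm_isomorphic_copies_singleton(1)[OF C(1)] dom])
    from pm_isomorphic_copies_cycle_imp[OF A this] pm_isomorphic_card[OF L] C(2) show ?R
      by simp
  next
    assume R: ?R
    obtain I :: "'a set" where I: "pm_isomorphic A (copies I (cycle_algebra n))"
      using pm_isomorphic_copies_cycleI[of A n] R \<open>0 < n\<close> by metis
    \<comment> \<open>Counting yields \<open>card I * n = n\<close>. An infinite \<open>I\<close> is
      excluded as well, since its \<open>card\<close> would be 0.\<close>
    have "card (I \<times> {0..<n}) = card (pm_carrier A)"
      using pm_isomorphic_card[OF I] by (simp add: copies_def cycle_algebra_def)
    also have "\<dots> = n" using R by blast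
    finally have "card (I \<times> {0..<n}) = n" .
    then have "card I = 1" using \<open>0 < n\<close> by (simp add: card_cartesian_product)
    then obtain u where "I = {u}" using card_1_singletonE by blast
    with I show ?L
      using pm_isomorphic_trans[OF _ pm_isomorphic_copies_singleton(2)[OF C(1)] dom] by simp
  qed
qed

lemma relational_form_total:
  assumes "dom (pm_op A) = pm_carrier A"
  shows "relational_form A = fun_graph (pm_carrier A) (the \<circ> pm_op A)"
  using assms by (auto simp: relational_form_def fun_graph_def)

theorem theorem4p17:
  fixes M :: "'a pair_pre_digraph"
  assumes "directed_pseudoforest M"
  shows "ultrahomogeneous M \<longleftrightarrow>
    (\<exists>A :: 'a pm_algebra. partial_monounary_algebra A \<and> M = relational_form A \<and>
       ((\<exists>I :: 'a set. pm_isomorphic A (copies I (cycle_algebra 2))) \<or>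
        (\<exists>I :: 'a set. pm_isomorphic A (copies I (cycle_algebra 3))) \<or>
        pm_isomorphic A (cycle_algebra 4) \<or>
        (\<exists>B :: 'a pm_algebra. partial_monounary_algebra B \<and> dom (pm_op B) = {} \<and>
           pm_isomorphic A B)))" (is "_ \<longleftrightarrow> ?R")
proof
  have wf: "\<And>x y. (x, y) \<in> parcs M \<Longrightarrow> x \<in> pverts M \<and> y \<in> pverts M \<and> x \<noteq> y"
    and nonempty: "pverts M \<noteq> {}" and sv: "single_valued (parcs M)"
    using assms
    by (auto simp: directed_pseudoforest_def pair_loopfree_digraph_def
        pair_loopfree_digraph_axioms_def pair_wf_digraph_def)
  assume uh: "ultrahomogeneous M"
  show ?R
  proof (cases "parcs M = {}")
    case True
    let ?A = "\<lparr>pm_carrier = pverts M, pm_op = Map.empty\<rparr>"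
    have "pm_isomorphic ?A ?A" by (auto simp: pm_isomorphic_def pm_isomorphism_def intro: exI[of _ id])
    moreover have "M = relational_form ?A" using True by (simp add: relational_form_def)
    moreover have "partial_monounary_algebra ?A" "dom (pm_op ?A) = {}"
      using nonempty by (simp_all add: partial_monounary_algebra_def)
    ultimately show ?thesis by blast
  next
    case False
    then obtain a b where ab: "(a, b) \<in> parcs M" by auto
    have total: "\<exists>y. (x, y) \<in> parcs M" if x: "x \<in> pverts M" for x
    proof -
      have pwf: "pair_wf_digraph M" using wf by (auto simp: pair_wf_digraph_def)
      \<comment> \<open>The automorphism carrying \<open>a\<close> to \<open>x\<close> turns the arc
        \<open>(a, b)\<close> into one leaving \<open>x\<close>.\<close>
      obtain g where g: "pair_isomorphism M M g" "g a = x"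
        using uh[unfolded ultrahomogeneous_iff[OF pwf], rule_format, of "{a}" "\<lambda>_. x"]
          wf x wf[OF ab] by auto
      then have "(g a, g b) \<in> parcs M" 
        using g(1) wf[OF ab] ab unfolding pair_isomorphism_def by blast
      then show ?thesis using g by blast
    qed
    define f where "f x = (THE y. (x, y) \<in> parcs M)" for x
    have f: "(x, y) \<in> parcs M \<longleftrightarrow> x \<in> pverts M \<and> y = f x" for x y
    proof -
      have "f x = z" if "(x, z) \<in> parcs M" for z
        unfolding f_def using sv that by (intro the_equality) (auto dest: single_valuedD)
      then show ?thesis using total wf by blast
    qed
    let ?A = "\<lparr>pm_carrier = pverts M, pm_op = (\<lambda>x. if x \<in> pverts M then Some (f x) else None)\<rparr>"
    have "f x \<in> pverts M \<and> f x \<noteq> x" if "x \<in> pverts M" for x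
      using wf[of x "f x"] f[of x "f x"] that by auto
    then have fV: "f \<in> pverts M \<rightarrow> pverts M" and ne: "\<And>x. x \<in> pverts M \<Longrightarrow> f x \<noteq> x"
      by blast+
    have "parcs M = {(x, f x) | x. x \<in> pverts M}" using f by auto
    then have M: "M = fun_graph (pverts M) f" by (simp add: fun_graph_def)
    have dom: "dom (pm_op ?A) = pm_carrier ?A" by (auto split: if_splits)
    have A: "partial_monounary_algebra ?A"
      using nonempty fV by (auto simp: partial_monounary_algebra_def ran_def split: if_splits)
    have rel: "M = relational_form ?A"
      by (subst M) (auto simp: relational_form_def fun_graph_def split: if_splits)
    \<comment> \<open>The two functions are known to agree only on vertices, since outside them both
      values are unspecified. The iterates agree because they stay inside
      \<open>pverts M\<close>.\<close>
    have cyc_eq: "uniform_cycles n (pverts M) (the \<circ> pm_op ?A) = uniform_cycles n (pverts M) f" for n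
    proof -
      have "((the \<circ> pm_op ?A) ^^ k) x = (f ^^ k) x" if "x \<in> pverts M" for k x
        using funpow_in[OF fV that] by (induction k) auto
      then show ?thesis using fV by (auto simp: uniform_cycles_def)
    qed
    have "uniform_cycles 2 (pverts M) f \<or> uniform_cycles 3 (pverts M) f \<or>
        uniform_cycles 4 (pverts M) f \<and> card (pverts M) = 4"
      using ultrahomogeneous_fun_graph_cycles[of "pverts M" f] uh M fV ne nonempty by simp
    then have "(\<exists>I :: 'a set. pm_isomorphic ?A (copies I (cycle_algebra 2))) \<or>
        (\<exists>I :: 'a set. pm_isomorphic ?A (copies I (cycle_algebra 3))) \<or>
        pm_isomorphic ?A (cycle_algebra 4)"
      using pm_isomorphic_copies_cycleI[OF dom] pm_isomorphic_cycle_iff[OF A] dom cyc_eq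
      by (elim disjE) simp_all
    then show ?thesis using A rel by blast
  qed
next
  assume ?R
  then obtain A :: "'a pm_algebra" where A: "partial_monounary_algebra A" and M: "M = relational_form A"
    and cases: "(\<exists>I :: 'a set. pm_isomorphic A (copies I (cycle_algebra 2))) \<or>
        (\<exists>I :: 'a set. pm_isomorphic A (copies I (cycle_algebra 3))) \<or>
        pm_isomorphic A (cycle_algebra 4) \<or>
        (\<exists>B :: 'a pm_algebra. partial_monounary_algebra B \<and> dom (pm_op B) = {} \<and>
           pm_isomorphic A B)" by blast
  let ?f = "the \<circ> pm_op A" and ?V = "pm_carrier A"
  consider "dom (pm_op A) = ?V" "uniform_cycles 2 ?V ?f \<or> uniform_cycles 3 ?V ?f"
    | "dom (pm_op A) = ?V" "uniform_cycles 4 ?V ?f" "card ?V = 4"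
    | "dom (pm_op A) = {}"
  proof -
    have "dom (pm_op A) = {}" if "pm_isomorphic A B" "dom (pm_op B) = {}" for B :: "'a pm_algebra"
      using that A unfolding pm_isomorphic_def pm_isomorphism_def partial_monounary_algebra_def
      by blast
    \<comment> \<open>The term \<open>num.Bit0 (num.Bit0 num.One)\<close> is the numeral 4, so the
      instance supplies \<open>0 < 4\<close>.\<close>
    then show ?thesis
      using cases that pm_isomorphic_copies_cycle_imp[OF A]
        pm_isomorphic_cycle_iff[OF A zero_less_numeral, of "num.Bit0 (num.Bit0 num.One)"] by blast
  qed
  then show "ultrahomogeneous M"
  proof cases
    case 1
    then show ?thesis using ultrahomogeneous_cycles_2_3 by (simp add: M relational_form_total)
  next
    case 2
    then show ?thesis using ultrahomogeneous_single_4_cycle by (simp add: M relational_form_total)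
  next
    case 3
    then show ?thesis by (intro ultrahomogeneous_arcless) (simp add: M relational_form_def)
  qed
qed

end
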